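(* Let $p$ be a smooth real function on an open interval $\Omega_u\subset\mathbb R$ and $a$ a constant such that $0<p'(u)<a^2$ for all $u\in\Omega_u$. Consider the relaxation model $$\partial_tu+\nabla\cdot\hat v=0,\qquad\partial_t\hat v+\frac1{\varepsilon^2}\nabla\hat w=-\frac{\hat v}{\varepsilon^2},\qquad\partial_t\hat w+a^2\nabla\cdot\hat v=\frac1{\varepsilon^2}\big(p(u)-\hat w\big),$$ with $u,\hat w$ scalar and $\hat v\in\mathbb R^d$ functions of $(x,t)$, $x\in\mathbb R^d$. With $v=\varepsilon\hat v$ and $w=\hat w-p(u)$ it becomes $$\partial_tu+\frac1\varepsilon\nabla\cdot v=0,\qquad\partial_tv+\frac1\varepsilon\nabla\big(w+p(u)\big)=-\frac1{\varepsilon^2}v,\qquad\partial_tw+\frac1\varepsilon\big(a^2-p'(u)\big)\nabla\cdot v=-\frac1{\varepsilon^2}w.$$ Then this transformed system, with conserved variable $u$ and relaxed variables $(v,w)\in\mathbb R^{d+1}$, satisfies the convergence criteria (i)-(v) listed in the context, and its limit equation (as defined in the context) is the nonlinear diffusion equation $\partial_tu-\Delta p(u)=0$.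
   Context: Convergence criteria. Let $\partial_tU+\frac1\varepsilon\sum_{j=1}^dA_j(U;\varepsilon)\partial_{x_j}U=\frac1{\varepsilon^2}Q(U;\varepsilon)$ be a first-order system for $U=(u,W)^T\in\Omega\subset\mathbb R^n$, $u\in\mathbb R^{n-r}$, $W\in\mathbb R^r$ (relaxed variables), with parameter $\varepsilon\in(0,1]$; $A_j$ and $Q$ are smooth in $(U;\varepsilon)$, up to $\varepsilon=0$. $\Omega_u\subset\mathbb R^{n-r}$ is an open convex set (the state space of $u$), $\Omega$ is open, $(u,W)\in\Omega$ implies $u\in\Omega_u$, and $(u,0)\in\Omega$ for $u\in\Omega_u$. An $n\times n$ matrix $A$ is partitioned as $\begin{pmatrix} A^{11} & A^{12} \\ A^{21} & A^{22} \end{pmatrix}$ according to $n=(n-r)+r$. The criteria are: (i) $Q(U;\varepsilon)=(0,q(U;\varepsilon))^T$ with $q$ a smooth $\mathbb R^r$-valued function. (ii) $q(u,W;0)=0$ if and only if $W=0$, and $\partial_Wq(u,0;0)$ is invertible for all $u\in\Omega_u$. (iii) There is a symmetric positive definite matrix $A_0(U;\varepsilon)$ (symmetrizer) such that $A_0(U;\varepsilon)A_j(U;\varepsilon)=A_j(U;\varepsilon)^TA_0(U;\varepsilon)$ for all $U\in\Omega$ and all $j$. (iv) With this $A_0$, there is a symmetric positive definite $r\times r$ matrix $S(u)$ such that $A_0(u,0;0)\,\partial_UQ(u,0;0)+(\partial_UQ(u,0;0))^TA_0(u,0;0)\le-\begin{pmatrix} 0 & 0 \\ 0 & S(u) \end{pmatrix}$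 for all $u\in\Omega_u$. (v) $A_j^{11}(u,0;0)=0$ and $\partial_uA_j^{11}(u,0;0)=0$ for all $u\in\Omega_u$ and all $j$. Limit equation. This is the equation for the leading term $u_0$ in the formal expansion $u\sim u_0+\varepsilon u_1+\cdots$, $W\sim W_0+\varepsilon W_1+\cdots$; explicitly $W_0=0$, $W_1=\partial_Wq(u_0,0;0)^{-1}\big[\sum_jA_j^{21}(u_0,0;0)\partial_{x_j}u_0-\partial_\varepsilon q(u_0,0;0)\big]$ and $$\partial_tu_0+\sum_jA_j^{12}(u_0,0;0)\partial_{x_j}W_1+\sum_j\big(\partial_WA_j^{11}(u_0,0;0)[W_1]\big)\partial_{x_j}u_0+\sum_j\partial_\varepsilon A_j^{11}(u_0,0;0)\partial_{x_j}u_0=0.$$ For the system in the claim, $n=d+2$, $r=d+1$. *)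

theory Defs
  imports "HOL-Analysis.Analysis"
begin

section \<open>Smooth functions\<close>

text \<open>\<open>Ck_on k S f\<close>: \<open>f\<close> is \<open>k\<close> times continuously differentiable. Intended for open \<open>S\<close>.\<close>

primrec Ck_on :: "nat \<Rightarrow> 'a::real_normed_vector set \<Rightarrow> ('a \<Rightarrow> 'b::real_normed_vector) \<Rightarrow> bool" where
  "Ck_on 0 S f \<longleftrightarrow> continuous_on S f"
| "Ck_on (Suc k) S f \<longleftrightarrow>
     (\<forall>x\<in>S. f differentiable (at x)) \<and>
     (\<forall>v. Ck_on k S (\<lambda>x. frechet_derivative f (at x) v))"

definition smooth_on :: "'a::real_normed_vector set \<Rightarrow> ('a \<Rightarrow> 'b::real_normed_vector) \<Rightarrow> bool" where
  "smooth_on S f \<longleftrightarrow> (\<forall>k. Ck_on k S f)"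

text \<open>Smoothness on a set that need not be open (used for \<open>\<Omega> \<times> [0,1]\<close>, i.e. up to \<open>\<epsilon> = 0\<close>):
  restriction of a smooth function on an open neighbourhood.\<close>

definition smooth_upto :: "'a::real_normed_vector set \<Rightarrow> ('a \<Rightarrow> 'b::real_normed_vector) \<Rightarrow> bool" where
  "smooth_upto S f \<longleftrightarrow> (\<exists>N g. open N \<and> S \<subseteq> N \<and> smooth_on N g \<and> (\<forall>x\<in>S. g x = f x))"


section \<open>Differential operators in \<open>(t, x)\<close>\<close>

definition dt :: "(real \<Rightarrow> 'x \<Rightarrow> 'b::real_normed_vector) \<Rightarrow> real \<Rightarrow> 'x \<Rightarrow> 'b" where
  "dt f t x = vector_derivative (\<lambda>s. f s x) (at t)"

definition partial :: "'d::finite \<Rightarrow> (real^'d \<Rightarrow> 'b::real_normed_vector) \<Rightarrow> real^'d \<Rightarrow> 'b" where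
  "partial j f x = vector_derivative (\<lambda>h. f (x + h *\<^sub>R axis j 1)) (at 0)"

definition grad :: "(real^'d \<Rightarrow> real) \<Rightarrow> real^'d \<Rightarrow> real^'d::finite" where
  "grad f x = (\<chi> j. partial j f x)"

definition divergence :: "(real^'d \<Rightarrow> real^'d::finite) \<Rightarrow> real^'d \<Rightarrow> real" where
  "divergence f x = (\<Sum>j\<in>UNIV. partial j (\<lambda>y. f y $ j) x)"

definition laplacian :: "(real^'d::finite \<Rightarrow> real) \<Rightarrow> real^'d \<Rightarrow> real" where
  "laplacian f x = (\<Sum>j\<in>UNIV. partial j (partial j f) x)"

definition differentiable_tx ::
  "real set \<Rightarrow> (real \<Rightarrow> real^'d::finite \<Rightarrow> 'b::real_normed_vector) \<Rightarrow> bool" where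
  "differentiable_tx T f \<longleftrightarrow>
     (\<forall>t\<in>T. \<forall>x. (\<lambda>s. f s x) differentiable (at t) \<and> f t differentiable (at x))"


section \<open>Block vectors and matrices, matrix inequalities\<close>

text \<open>A state \<open>U = (u, W)\<close> with \<open>u \<in> \<real>\<^sup>n\<^sup>-\<^sup>r\<close>, \<open>W \<in> \<real>\<^sup>r\<close> is a vector indexed by the sum type \<open>'m + 'r\<close>,
  where \<open>CARD('m) = n - r\<close> and \<open>CARD('r) = r\<close>.\<close>

definition join :: "real^'m \<Rightarrow> real^'r \<Rightarrow> real^('m::finite + 'r::finite)" where
  "join u W = (\<chi> k. case k of Inl i \<Rightarrow> u $ i | Inr i \<Rightarrow> W $ i)"

definition upper :: "real^('m::finite + 'r::finite) \<Rightarrow> real^'m" where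
  "upper U = (\<chi> i. U $ Inl i)"

definition lower :: "real^('m::finite + 'r::finite) \<Rightarrow> real^'r" where
  "lower U = (\<chi> i. U $ Inr i)"

definition blk11 :: "real^('m + 'r)^('m::finite + 'r::finite) \<Rightarrow> real^'m^'m" where
  "blk11 M = (\<chi> i k. M $ Inl i $ Inl k)"

definition blk12 :: "real^('m + 'r)^('m::finite + 'r::finite) \<Rightarrow> real^'r^'m" where
  "blk12 M = (\<chi> i k. M $ Inl i $ Inr k)"

definition blk21 :: "real^('m + 'r)^('m::finite + 'r::finite) \<Rightarrow> real^'m^'r" where
  "blk21 M = (\<chi> i k. M $ Inr i $ Inl k)"

definition lower_block_matrix :: "real^'r^'r \<Rightarrow> real^('m + 'r)^('m::finite + 'r::finite)" where
  "lower_block_matrix S =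
     (\<chi> i k. case (i, k) of (Inr i', Inr k') \<Rightarrow> S $ i' $ k' | _ \<Rightarrow> 0)"

definition sym_pos_def :: "real^'n^'n::finite \<Rightarrow> bool" where
  "sym_pos_def M \<longleftrightarrow> transpose M = M \<and> (\<forall>\<xi>. \<xi> \<noteq> 0 \<longrightarrow> \<xi> \<bullet> (M *v \<xi>) > 0)"

definition loewner_le :: "real^'n^'n \<Rightarrow> real^'n^'n::finite \<Rightarrow> bool" where
  "loewner_le M N \<longleftrightarrow> (\<forall>\<xi>. \<xi> \<bullet> (M *v \<xi>) \<le> \<xi> \<bullet> (N *v \<xi>))"


section \<open>First-order systems with a small parameter\<close>

text \<open>Coefficients: \<open>A j U \<epsilon>\<close> and \<open>Q U \<epsilon>\<close>; unknown \<open>U t x\<close>. The index \<open>j\<close> ranges over the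
  coordinates of \<open>x \<in> \<real>\<^sup>d\<close>.\<close>

definition solves_system ::
  "('d::finite \<Rightarrow> real^'n \<Rightarrow> real \<Rightarrow> real^'n^'n) \<Rightarrow> (real^'n \<Rightarrow> real \<Rightarrow> real^'n::finite) \<Rightarrow>
   real \<Rightarrow> real set \<Rightarrow> (real \<Rightarrow> real^'d \<Rightarrow> real^'n) \<Rightarrow> bool" where
  "solves_system A Q \<epsilon> T U \<longleftrightarrow> (\<forall>t\<in>T. \<forall>x.
     dt U t x + (1/\<epsilon>) *\<^sub>R (\<Sum>j\<in>UNIV. A j (U t x) \<epsilon> *v partial j (U t) x)
       = (1/\<epsilon>\<^sup>2) *\<^sub>R Q (U t x) \<epsilon>)"

definition admissible_system ::
  "(real^'m) set \<Rightarrow> (real^('m + 'r)) set \<Rightarrow>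
   ('d::finite \<Rightarrow> real^('m::finite + 'r::finite) \<Rightarrow> real \<Rightarrow> real^('m + 'r)^('m + 'r)) \<Rightarrow>
   (real^('m + 'r) \<Rightarrow> real \<Rightarrow> real^('m + 'r)) \<Rightarrow> bool" where
  "admissible_system \<Omega>u \<Omega> A Q \<longleftrightarrow>
     open \<Omega>u \<and> convex \<Omega>u \<and> open \<Omega> \<and>
     (\<forall>u W. join u W \<in> \<Omega> \<longrightarrow> u \<in> \<Omega>u) \<and> (\<forall>u\<in>\<Omega>u. join u 0 \<in> \<Omega>) \<and>
     (\<forall>j. smooth_upto (\<Omega> \<times> {0..1}) (\<lambda>(U, \<epsilon>). A j U \<epsilon>)) \<and>
     smooth_upto (\<Omega> \<times> {0..1}) (\<lambda>(U, \<epsilon>). Q U \<epsilon>)"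

subsection \<open>Convergence criteria\<close>

definition criterion_i ::
  "(real^('m + 'r)) set \<Rightarrow> (real^('m::finite + 'r::finite) \<Rightarrow> real \<Rightarrow> real^('m + 'r)) \<Rightarrow>
   (real^('m + 'r) \<Rightarrow> real \<Rightarrow> real^'r) \<Rightarrow> bool" where
  "criterion_i \<Omega> Q q \<longleftrightarrow>
     smooth_upto (\<Omega> \<times> {0..1}) (\<lambda>(U, \<epsilon>). q U \<epsilon>) \<and>
     (\<forall>U\<in>\<Omega>. \<forall>\<epsilon>\<in>{0..1}. Q U \<epsilon> = join 0 (q U \<epsilon>))"

definition criterion_ii ::
  "(real^'m) set \<Rightarrow> (real^('m + 'r)) set \<Rightarrow>
   (real^('m::finite + 'r::finite) \<Rightarrow> real \<Rightarrow> real^'r) \<Rightarrow> bool" where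
  "criterion_ii \<Omega>u \<Omega> q \<longleftrightarrow>
     (\<forall>u W. join u W \<in> \<Omega> \<longrightarrow> (q (join u W) 0 = 0 \<longleftrightarrow> W = 0)) \<and>
     (\<forall>u\<in>\<Omega>u. invertible (jacobian (\<lambda>W. q (join u W) 0) (at 0)))"

definition criterion_iii ::
  "(real^'n) set \<Rightarrow> ('d::finite \<Rightarrow> real^'n \<Rightarrow> real \<Rightarrow> real^'n^'n) \<Rightarrow>
   (real^'n \<Rightarrow> real \<Rightarrow> real^'n^'n::finite) \<Rightarrow> bool" where
  "criterion_iii \<Omega> A A0 \<longleftrightarrow>
     (\<forall>U\<in>\<Omega>. \<forall>\<epsilon>\<in>{0..1}. sym_pos_def (A0 U \<epsilon>) \<and>
        (\<forall>j. A0 U \<epsilon> ** A j U \<epsilon> = transpose (A j U \<epsilon>) ** A0 U \<epsilon>))"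

definition criterion_iv ::
  "(real^'m) set \<Rightarrow> (real^('m::finite + 'r::finite) \<Rightarrow> real \<Rightarrow> real^('m + 'r)) \<Rightarrow>
   (real^('m + 'r) \<Rightarrow> real \<Rightarrow> real^('m + 'r)^('m + 'r)) \<Rightarrow> bool" where
  "criterion_iv \<Omega>u Q A0 \<longleftrightarrow>
     (\<exists>S :: real^'m \<Rightarrow> real^'r^'r. \<forall>u\<in>\<Omega>u. sym_pos_def (S u) \<and>
        (let M = A0 (join u 0) 0; DQ = jacobian (\<lambda>U. Q U 0) (at (join u 0))
         in loewner_le (M ** DQ + transpose DQ ** M) (- lower_block_matrix (S u))))"

definition criterion_v ::
  "(real^'m) set \<Rightarrow>
   ('d::finite \<Rightarrow> real^('m::finite + 'r::finite) \<Rightarrow> real \<Rightarrow> real^('m + 'r)^('m + 'r)) \<Rightarrow> bool" where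
  "criterion_v \<Omega>u A \<longleftrightarrow>
     (\<forall>u\<in>\<Omega>u. \<forall>j. blk11 (A j (join u 0) 0) = 0 \<and>
        frechet_derivative (\<lambda>y. blk11 (A j (join y 0) 0)) (at u) = (\<lambda>_. 0))"

definition convergence_criteria ::
  "(real^'m) set \<Rightarrow> (real^('m + 'r)) set \<Rightarrow>
   ('d::finite \<Rightarrow> real^('m::finite + 'r::finite) \<Rightarrow> real \<Rightarrow> real^('m + 'r)^('m + 'r)) \<Rightarrow>
   (real^('m + 'r) \<Rightarrow> real \<Rightarrow> real^('m + 'r)) \<Rightarrow> bool" where
  "convergence_criteria \<Omega>u \<Omega> A Q \<longleftrightarrow>
     (\<exists>q. criterion_i \<Omega> Q q \<and> criterion_ii \<Omega>u \<Omega> q) \<and>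
     (\<exists>A0. criterion_iii \<Omega> A A0 \<and> criterion_iv \<Omega>u Q A0) \<and>
     criterion_v \<Omega>u A"

subsection \<open>Limit equation\<close>

text \<open>Under criterion (i), \<open>q U \<epsilon> = lower (Q U \<epsilon>)\<close>. Since \<open>\<epsilon>\<close> is restricted to \<open>[0,1]\<close>,
  \<open>\<partial>\<^sub>\<epsilon>\<close> at \<open>\<epsilon> = 0\<close> is the one-sided derivative.\<close>

definition limit_W1 ::
  "('d::finite \<Rightarrow> real^('m::finite + 'r::finite) \<Rightarrow> real \<Rightarrow> real^('m + 'r)^('m + 'r)) \<Rightarrow>
   (real^('m + 'r) \<Rightarrow> real \<Rightarrow> real^('m + 'r)) \<Rightarrow>
   (real \<Rightarrow> real^'d \<Rightarrow> real^'m) \<Rightarrow> real \<Rightarrow> real^'d \<Rightarrow> real^'r" where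
  "limit_W1 A Q u0 t x =
     matrix_inv (jacobian (\<lambda>W. lower (Q (join (u0 t x) W) 0)) (at 0)) *v
       ((\<Sum>j\<in>UNIV. blk21 (A j (join (u0 t x) 0) 0) *v partial j (u0 t) x)
        - vector_derivative (\<lambda>\<epsilon>. lower (Q (join (u0 t x) 0) \<epsilon>)) (at 0 within {0..1}))"

definition limit_lhs ::
  "('d::finite \<Rightarrow> real^('m::finite + 'r::finite) \<Rightarrow> real \<Rightarrow> real^('m + 'r)^('m + 'r)) \<Rightarrow>
   (real^('m + 'r) \<Rightarrow> real \<Rightarrow> real^('m + 'r)) \<Rightarrow>
   (real \<Rightarrow> real^'d \<Rightarrow> real^'m) \<Rightarrow> real \<Rightarrow> real^'d \<Rightarrow> real^'m" where
  "limit_lhs A Q u0 t x =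
     dt u0 t x
     + (\<Sum>j\<in>UNIV. blk12 (A j (join (u0 t x) 0) 0) *v partial j (limit_W1 A Q u0 t) x)
     + (\<Sum>j\<in>UNIV. frechet_derivative (\<lambda>W. blk11 (A j (join (u0 t x) W) 0)) (at 0)
                  (limit_W1 A Q u0 t x) *v partial j (u0 t) x)
     + (\<Sum>j\<in>UNIV. vector_derivative (\<lambda>\<epsilon>. blk11 (A j (join (u0 t x) 0) \<epsilon>)) (at 0 within {0..1})
                  *v partial j (u0 t) x)"

definition solves_limit_equation ::
  "('d::finite \<Rightarrow> real^('m::finite + 'r::finite) \<Rightarrow> real \<Rightarrow> real^('m + 'r)^('m + 'r)) \<Rightarrow>
   (real^('m + 'r) \<Rightarrow> real \<Rightarrow> real^('m + 'r)) \<Rightarrow>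
   real set \<Rightarrow> (real \<Rightarrow> real^'d \<Rightarrow> real^'m) \<Rightarrow> bool" where
  "solves_limit_equation A Q T u0 \<longleftrightarrow> (\<forall>t\<in>T. \<forall>x. limit_lhs A Q u0 t x = 0)"


section \<open>The relaxation model\<close>

definition relaxation_model ::
  "(real \<Rightarrow> real) \<Rightarrow> real \<Rightarrow> real \<Rightarrow> real set \<Rightarrow> (real \<Rightarrow> real^'d \<Rightarrow> real) \<Rightarrow>
   (real \<Rightarrow> real^'d \<Rightarrow> real^'d::finite) \<Rightarrow> (real \<Rightarrow> real^'d \<Rightarrow> real) \<Rightarrow> bool" where
  "relaxation_model p a \<epsilon> T u vh wh \<longleftrightarrow> (\<forall>t\<in>T. \<forall>x.
     dt u t x + divergence (vh t) x = 0 \<and>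
     dt vh t x + (1/\<epsilon>\<^sup>2) *\<^sub>R grad (wh t) x = - ((1/\<epsilon>\<^sup>2) *\<^sub>R vh t x) \<and>
     dt wh t x + a\<^sup>2 * divergence (vh t) x = (1/\<epsilon>\<^sup>2) * (p (u t x) - wh t x))"

definition transformed_model ::
  "(real \<Rightarrow> real) \<Rightarrow> real \<Rightarrow> real \<Rightarrow> real set \<Rightarrow> (real \<Rightarrow> real^'d \<Rightarrow> real) \<Rightarrow>
   (real \<Rightarrow> real^'d \<Rightarrow> real^'d::finite) \<Rightarrow> (real \<Rightarrow> real^'d \<Rightarrow> real) \<Rightarrow> bool" where
  "transformed_model p a \<epsilon> T u v w \<longleftrightarrow> (\<forall>t\<in>T. \<forall>x.
     dt u t x + (1/\<epsilon>) * divergence (v t) x = 0 \<and>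
     dt v t x + (1/\<epsilon>) *\<^sub>R grad (\<lambda>y. w t y + p (u t y)) x = - ((1/\<epsilon>\<^sup>2) *\<^sub>R v t x) \<and>
     dt w t x + (1/\<epsilon>) * (a\<^sup>2 - deriv p (u t x)) * divergence (v t) x = - ((1/\<epsilon>\<^sup>2) * w t x))"

text \<open>The transformed model as a system for \<open>U = (u, (v, w))\<close>. Rows and columns are indexed by
  \<open>1 + ('d + 1)\<close>: \<open>Inl _\<close> is \<open>u\<close>, \<open>Inr (Inl l)\<close> is \<open>v\<^sub>l\<close>, \<open>Inr (Inr _)\<close> is \<open>w\<close>. The term
  \<open>\<nabla>(w + p(u))\<close> is written as \<open>\<nabla>w + p'(u) \<nabla>u\<close>.\<close>

definition pack :: "real \<Rightarrow> real^'d \<Rightarrow> real \<Rightarrow> real^(1 + ('d::finite + 1))" where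
  "pack u v w = join (vec u) (join v (vec w))"

definition model_A ::
  "(real \<Rightarrow> real) \<Rightarrow> real \<Rightarrow> 'd::finite \<Rightarrow> real^(1 + ('d + 1)) \<Rightarrow> real \<Rightarrow>
   real^(1 + ('d + 1))^(1 + ('d + 1))" where
  "model_A p a j U \<epsilon> = (\<chi> i k. case (i, k) of
       (Inl _, Inr (Inl l)) \<Rightarrow> (if l = j then 1 else 0)
     | (Inr (Inl l), Inl _) \<Rightarrow> (if l = j then deriv p (U $ Inl 1) else 0)
     | (Inr (Inl l), Inr (Inr _)) \<Rightarrow> (if l = j then 1 else 0)
     | (Inr (Inr _), Inr (Inl l)) \<Rightarrow> (if l = j then a\<^sup>2 - deriv p (U $ Inl 1) else 0)
     | _ \<Rightarrow> 0)"

definition model_Q :: "real^(1 + ('d::finite + 1)) \<Rightarrow> real \<Rightarrow> real^(1 + ('d + 1))" where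
  "model_Q U \<epsilon> = join 0 (- lower U)"

definition model_\<Omega>u :: "real set \<Rightarrow> (real^1) set" where
  "model_\<Omega>u I = {y. y $ 1 \<in> I}"

definition model_\<Omega> :: "real set \<Rightarrow> (real^(1 + ('d::finite + 1))) set" where
  "model_\<Omega> I = {U. U $ Inl 1 \<in> I}"

definition solves_diffusion ::
  "(real \<Rightarrow> real) \<Rightarrow> real set \<Rightarrow> (real \<Rightarrow> real^'d::finite \<Rightarrow> real) \<Rightarrow> bool" where
  "solves_diffusion p T u \<longleftrightarrow> (\<forall>t\<in>T. \<forall>x. dt u t x - laplacian (\<lambda>y. p (u t y)) x = 0)"

end

theory Submission
  imports Defs
begin

text \<open>
  The relaxed variables decay under the source \<open>q(U) = - W\<close>, and the flux matrices depend on \<open>U\<close>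
  only through the number \<open>p'(u)\<close>. The inequalities \<open>0 < p'(u) < a\<^sup>2\<close> are what makes a diagonal
  symmetrizer positive definite. The only contributions to the limit equation come from
  \<open>W\<^sub>1 = (- p'(u) \<nabla>u, 0) = (- \<nabla>p(u), 0)\<close>, whose divergence is \<open>- \<Delta>p(u)\<close>: the \<open>(1,1)\<close> blocks vanish
  identically and the source does not depend on \<open>\<epsilon>\<close>.
\<close>

section \<open>Calculus of \<open>Ck_on\<close>\<close>

text \<open>On an open set the Frechet derivative at a point depends only on nearby values, so
  derivatives of \<open>f\<close> and \<open>g\<close> agree on \<open>S\<close> and the induction
  can be repeated with them. This permits replacing a \<open>frechet_derivative\<close> inside
  \<open>Ck_on\<close> by a formula known only on \<open>S\<close>.\<close>

lemma Ck_on_cong: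
  fixes f g :: "'a::real_normed_vector \<Rightarrow> 'b::real_normed_vector"
  assumes "open S" "\<And>x. x \<in> S \<Longrightarrow> f x = g x"
  shows "Ck_on k S f \<longleftrightarrow> Ck_on k S g"
  using assms(2)
proof (induction k arbitrary: f g)
  case 0
  then show ?case by (simp cong: continuous_on_cong)
next
  case (Suc k)
  \<comment> \<open>One implication, for arbitrary functions, so that it can be used again with the
    roles of \<open>f\<close> and \<open>g\<close> exchanged.\<close>
  have imp: "Ck_on (Suc k) S g'" if eq: "\<And>x. x \<in> S \<Longrightarrow> f' x = g' x" and f': "Ck_on (Suc k) S f'"
    for f' g' :: "'a \<Rightarrow> 'b"
  proof -
    have deriv_g': "(g' has_derivative frechet_derivative f' (at x)) (at x)" if "x \<in> S" for x
    proof (rule has_derivative_transform_within_open[OF _ assms(1) that eq])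
      show "(f' has_derivative frechet_derivative f' (at x)) (at x)"
        using f' that by (simp flip: frechet_derivative_works)
    qed
    have "frechet_derivative f' (at x) = frechet_derivative g' (at x)" if "x \<in> S" for x
      by (rule frechet_derivative_at[OF deriv_g'[OF that]])
    then have "Ck_on k S (\<lambda>x. frechet_derivative f' (at x) v) \<longleftrightarrow>
        Ck_on k S (\<lambda>x. frechet_derivative g' (at x) v)" for v
      by (intro Suc.IH) simp
    with deriv_g' f' show ?thesis
      unfolding Ck_on.simps by (auto simp: differentiable_def)
  qed
  show ?case using Suc.prems imp[of f g] imp[of g f] by (metis (full_types))
qed

lemma Ck_on_const: "Ck_on k S (\<lambda>x. c)"
  by (induction k arbitrary: c) auto

lemma Ck_on_bounded_linear:
  assumes "bounded_linear L"
  shows "Ck_on k S L"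
proof (cases k)
  case 0
  then show ?thesis using assms by (simp add: linear_continuous_on)
next
  case (Suc m)
  have "frechet_derivative L (at x) = L" for x
    by (rule frechet_derivative_at[OF bounded_linear_imp_has_derivative[OF assms], symmetric])
  then show ?thesis
    using Suc assms by (simp add: Ck_on_const bounded_linear_imp_differentiable)
qed

text \<open>Differentiation passes through \<open>L\<close>, so the derivative again has this form.
  It carries smoothness from the scalar p'(u) to the flux matrices without a product rule.\<close>

lemma Ck_on_affine:
  assumes "bounded_linear L" "open S" "Ck_on k S f"
  shows "Ck_on k S (\<lambda>x. c + L (f x))"
  using assms(3)
proof (induction k arbitrary: f c)
  case 0
  then show ?case
    by (simp add: continuous_on_add bounded_linear.continuous_on[OF assms(1)])
next
  case (Suc k)
  have D: "((\<lambda>x. c + L (f x)) has_derivative (\<lambda>v. L (frechet_derivative f (at x) v))) (at x)"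
    if "x \<in> S" for x
  proof -
    have "(f has_derivative frechet_derivative f (at x)) (at x)"
      using Suc.prems that by (simp flip: frechet_derivative_works)
    from has_derivative_add[OF has_derivative_const bounded_linear.has_derivative[OF assms(1) this]]
    show ?thesis by simp
  qed
  \<comment> \<open>The constant disappears under differentiation; the induction hypothesis is used
    with \<open>c = 0\<close>.\<close>
  have "Ck_on k S (\<lambda>x. 0 + L (frechet_derivative f (at x) v))" for v
    using Suc.prems by (intro Suc.IH) simp
  moreover have "Ck_on k S (\<lambda>x. frechet_derivative (\<lambda>x. c + L (f x)) (at x) v) \<longleftrightarrow>
      Ck_on k S (\<lambda>x. 0 + L (frechet_derivative f (at x) v))" for v
    by (intro Ck_on_cong assms(2)) (simp add: frechet_derivative_at[OF D, symmetric])
  ultimately show ?case using D by (auto simp: differentiable_def)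
qed

text \<open>For linear \<open>L\<close> the chain rule only changes the direction from
  \<open>v\<close> to the fixed vector \<open>L v\<close>. The derivative is therefore again a
  function of \<open>L x\<close>, to which the induction hypothesis applies.\<close>

lemma Ck_on_linear_substitution:
  assumes "bounded_linear L" "open S" "\<And>x. x \<in> S \<Longrightarrow> L x \<in> T" "Ck_on k T f"
  shows "Ck_on k S (\<lambda>x. f (L x))"
  using assms(4)
proof (induction k arbitrary: f)
  case 0
  then show ?case
    using continuous_on_compose2[OF _ linear_continuous_on[OF assms(1)], of T f S] assms(3) by auto
next
  case (Suc k)
  have D: "((\<lambda>x. f (L x)) has_derivative (\<lambda>v. frechet_derivative f (at (L x)) (L v))) (at x)"
    if "x \<in> S" for x
  proof (rule has_derivative_compose[OF bounded_linear_imp_has_derivative[OF assms(1)]])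
    show "(f has_derivative frechet_derivative f (at (L x))) (at (L x))"
      using Suc.prems assms(3)[OF that] by (simp flip: frechet_derivative_works)
  qed
  have "Ck_on k S (\<lambda>x. frechet_derivative f (at (L x)) (L v))" for v
    using Suc.IH[of "\<lambda>y. frechet_derivative f (at y) (L v)"] Suc.prems by simp
  moreover have "Ck_on k S (\<lambda>x. frechet_derivative (\<lambda>x. f (L x)) (at x) v) \<longleftrightarrow>
      Ck_on k S (\<lambda>x. frechet_derivative f (at (L x)) (L v))" for v
    by (intro Ck_on_cong assms(2)) (simp add: frechet_derivative_at[OF D, symmetric])
  ultimately show ?case using D by (auto simp: differentiable_def)
qed

section \<open>Smooth real functions and smoothness up to the boundary in the parameter\<close>

lemma smooth_on_imp_has_real_derivative:
  fixes p :: "real \<Rightarrow> real"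
  assumes "smooth_on S p" "y \<in> S"
  shows "(p has_real_derivative deriv p y) (at y)"
proof -
  have "Ck_on 1 S p" using assms(1) by (simp add: smooth_on_def)
  then have "p differentiable (at y)" using assms(2) by simp
  then show ?thesis
    by (auto simp: real_differentiable_def dest: DERIV_imp_deriv)
qed

text \<open>\<open>deriv p\<close> is the directional derivative of \<open>p\<close> in direction 1,
  at least on \<open>S\<close>; order \<open>Suc k\<close> for \<open>p\<close> gives order
  \<open>k\<close> for it.\<close>

lemma smooth_on_deriv:
  fixes p :: "real \<Rightarrow> real"
  assumes "open S" "smooth_on S p"
  shows "smooth_on S (deriv p)"
  unfolding smooth_on_def
proof
  fix k
  have "Ck_on (Suc k) S p" using assms(2) unfolding smooth_on_def by blast
  then have "Ck_on k S (\<lambda>y. frechet_derivative p (at y) 1)" by simp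
  moreover have "frechet_derivative p (at y) 1 = deriv p y" if "y \<in> S" for y
    using frechet_derivative_at[OF smooth_on_imp_has_real_derivative[OF assms(2) that,
          unfolded has_field_derivative_def]]
    by (metis mult.right_neutral)
  ultimately show "Ck_on k S (deriv p)" 
    using Ck_on_cong[OF assms(1), of "\<lambda>y. frechet_derivative p (at y) 1" "deriv p"] by simp
qed

text \<open>The required open neighbourhood is obtained by letting the parameter run over all reals,
  which suits coefficients that do not depend on \<epsilon>.\<close>

lemma smooth_upto_times:
  assumes "open S" "smooth_on (S \<times> UNIV) g"
  shows "smooth_upto (S \<times> E) g"
  unfolding smooth_upto_def using assms
  by (intro exI[of _ "S \<times> UNIV"] exI[of _ g]) (simp add: open_Times Sigma_mono)

section \<open>Partial derivatives\<close>

lemma dt_eqI: "((\<lambda>s. f s x) has_vector_derivative D) (at t) \<Longrightarrow> dt f t x = D"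
  by (simp add: dt_def vector_derivative_at)

lemma partial_eqI:
  "((\<lambda>h. f (x + h *\<^sub>R axis j 1)) has_vector_derivative D) (at 0) \<Longrightarrow> partial j f x = D"
  by (simp add: partial_def vector_derivative_at)

lemma has_vector_derivative_dt:
  "(\<lambda>s. f s x) differentiable (at t) \<Longrightarrow> ((\<lambda>s. f s x) has_vector_derivative dt f t x) (at t)"
  by (simp add: dt_def vector_derivative_works[symmetric])

text \<open>Chain rule along the line through \<open>x\<close> in direction \<open>v\<close>, with
  \<open>f' (h *\<^sub>R v) = h *\<^sub>R f' v\<close>; this links \<open>partial\<close> to the
  Frechet derivative.\<close>

lemma has_vector_derivative_line:
  assumes "(f has_derivative f') (at x)"
  shows "((\<lambda>h. f (x + h *\<^sub>R v)) has_vector_derivative f' v) (at 0)"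
proof -
  have "((\<lambda>h. x + h *\<^sub>R v) has_derivative (\<lambda>h. h *\<^sub>R v)) (at 0)"
    by (auto intro!: derivative_eq_intros)
  then have "((\<lambda>h. f (x + h *\<^sub>R v)) has_derivative (\<lambda>h. f' (h *\<^sub>R v))) (at 0)"
    by (rule has_derivative_compose) (use assms in simp)
  then show ?thesis
    unfolding has_vector_derivative_def linear_scale[OF has_derivative_linear[OF assms]] .
qed

lemma partial_eq_frechet_derivative:
  "f differentiable (at x) \<Longrightarrow> partial j f x = frechet_derivative f (at x) (axis j 1)"
  by (intro partial_eqI has_vector_derivative_line) (simp add: frechet_derivative_works)

lemma has_vector_derivative_partial:
  "f differentiable (at x) \<Longrightarrow>
    ((\<lambda>h. f (x + h *\<^sub>R axis j 1)) has_vector_derivative partial j f x) (at 0)"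
  by (simp add: partial_eq_frechet_derivative has_vector_derivative_line frechet_derivative_works)

lemma partial_bounded_linear:
  assumes "bounded_linear L" "f differentiable (at x)"
  shows "partial j (\<lambda>y. L (f y)) x = L (partial j f x)"
  by (intro partial_eqI bounded_linear.has_vector_derivative[OF assms(1)]
      has_vector_derivative_partial assms(2))

lemma dt_bounded_linear:
  assumes "bounded_linear L" "(\<lambda>s. f s x) differentiable (at t)"
  shows "dt (\<lambda>s y. L (f s y)) t x = L (dt f t x)"
  by (intro dt_eqI bounded_linear.has_vector_derivative[OF assms(1)]
      has_vector_derivative_dt assms(2))

lemma partial_compose_real:
  fixes f :: "real^'d::finite \<Rightarrow> real"
  assumes "(p has_real_derivative p') (at (f x))" "f differentiable (at x)"
  shows "partial j (\<lambda>y. p (f y)) x = p' * partial j f x"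
  using field_vector_diff_chain_at[OF has_vector_derivative_partial[OF assms(2)], of p p' j] assms(1)
  by (intro partial_eqI) (simp add: o_def mult.commute)

lemma partial_add:
  "f differentiable (at x) \<Longrightarrow> g differentiable (at x) \<Longrightarrow>
    partial j (\<lambda>y. f y + g y) x = partial j f x + partial j g x"
  by (intro partial_eqI has_vector_derivative_add has_vector_derivative_partial)

lemma partial_component:
  "v differentiable (at x) \<Longrightarrow> partial j (\<lambda>y. v y $ l) x = partial j v x $ l"
  by (rule partial_bounded_linear[OF bounded_linear_vec_nth])

lemma divergence_eq_sum:
  "v differentiable (at x) \<Longrightarrow> divergence v x = (\<Sum>j\<in>UNIV. partial j v x $ j)"
  by (simp add: divergence_def partial_component)

lemma divergence_scaleR:
  "v differentiable (at x) \<Longrightarrow> divergence (\<lambda>y. c *\<^sub>R v y) x = c * divergence v x"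
  by (simp add: divergence_eq_sum sum_distrib_left
      partial_bounded_linear[OF bounded_linear_scaleR_right])

section \<open>Block vectors\<close>

lemma sum_UNIV_Plus:
  "(\<Sum>k\<in>UNIV. f k) = (\<Sum>i\<in>UNIV. f (Inl i)) + (\<Sum>i\<in>UNIV. f (Inr i))"
  for f :: "'a::finite + 'b::finite \<Rightarrow> 'c::comm_monoid_add"
  by (simp flip: UNIV_Plus_UNIV add: sum.Plus)

lemma all_Plus: "(\<forall>k. P k) \<longleftrightarrow> (\<forall>i. P (Inl i)) \<and> (\<forall>i. P (Inr i))"
  by (metis sum.exhaust)

lemma join_nth [simp]: "join u W $ Inl i = u $ i" "join u W $ Inr k = W $ k"
  by (simp_all add: join_def)

lemma lower_join [simp]: "lower (join u W) = W"
  by (simp add: lower_def vec_eq_iff)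

lemma bounded_linear_lower: "bounded_linear lower"
  by (intro linear_conv_bounded_linear[THEN iffD1] linearI) (simp_all add: lower_def vec_eq_iff)

lemma bounded_linear_join_zero: "bounded_linear (join 0)"
  by (intro linear_conv_bounded_linear[THEN iffD1] linearI) (simp_all add: vec_eq_iff all_Plus)

lemma bounded_linear_vec: "bounded_linear (vec :: real \<Rightarrow> real^'n::finite)"
  by (intro linear_conv_bounded_linear[THEN iffD1] linearI) (simp_all add: vec_eq_iff)

section \<open>Packed states (u, v, w) and the action of the model coefficients on them\<close>

lemma pack_nth [simp]:
  "pack u v w $ Inl i = u" "pack u v w $ Inr (Inl l) = v $ l" "pack u v w $ Inr (Inr k) = w"
  by (simp_all add: pack_def)

lemma pack_eq_iff: "pack u v w = pack u' v' w' \<longleftrightarrow> u = u' \<and> v = v' \<and> w = w'"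
  by (auto simp: vec_eq_iff all_Plus)

lemma pack_add: "pack u v w + pack u' v' w' = pack (u + u') (v + v') (w + w')"
  by (simp add: vec_eq_iff all_Plus)

lemma pack_scaleR: "c *\<^sub>R pack u v w = pack (c * u) (c *\<^sub>R v) (c * w)"
  by (simp add: vec_eq_iff all_Plus)

text \<open>Read as a linear map on triples, \<open>pack\<close> transports differentiation of the
  three components to the packed state.\<close>

lemma bounded_linear_pack: "bounded_linear (\<lambda>(u, v, w). pack u v w)"
  by (intro linear_conv_bounded_linear[THEN iffD1] linearI) (auto simp: pack_add pack_scaleR)

lemma has_vector_derivative_pack:
  assumes "(u has_vector_derivative u') (at t within S)" "(v has_vector_derivative v') (at t within S)"
    "(w has_vector_derivative w') (at t within S)"
  shows "((\<lambda>s. pack (u s) (v s) (w s)) has_vector_derivative pack u' v' w') (at t within S)"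
  using bounded_linear.has_vector_derivative[OF bounded_linear_pack
      has_vector_derivative_Pair[OF assms(1) has_vector_derivative_Pair[OF assms(2,3)]]]
  by simp

lemma model_Q_pack: "model_Q (pack u v w) \<epsilon> = pack 0 (- v) (- w)"
  by (simp add: model_Q_def vec_eq_iff all_Plus lower_def)

lemma model_A_mult_pack:
  "model_A p a j U \<epsilon> *v pack x y z =
    pack (y $ j) ((deriv p (U $ Inl 1) * x + z) *\<^sub>R axis j 1) ((a\<^sup>2 - deriv p (U $ Inl 1)) * y $ j)"
  by (simp add: vec_eq_iff all_Plus matrix_vector_mult_def model_A_def sum_UNIV_Plus axis_def
      if_distrib[of "\<lambda>c. c * _"] cong: if_cong)

text \<open>With the j-th partial derivatives of u, v, w inserted for \<open>x j\<close>,
  \<open>y j\<close>, \<open>z j\<close>, the three slots become div v, p'(u) grad u + grad w and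
  (a^2 - p'(u)) div v.\<close>

lemma sum_model_A_mult_pack:
  "(\<Sum>j\<in>UNIV. model_A p a j U \<epsilon> *v pack (x j) (y j) (z j)) =
    pack (\<Sum>j\<in>UNIV. y j $ j) (\<chi> l. deriv p (U $ Inl 1) * x l + z l)
      ((a\<^sup>2 - deriv p (U $ Inl 1)) * (\<Sum>j\<in>UNIV. y j $ j))"
  by (simp add: model_A_mult_pack vec_eq_iff all_Plus axis_def sum_distrib_left
      if_distrib[of "\<lambda>c. _ * c"] cong: if_cong)


section \<open>Matrices\<close>

text \<open>A bounded linear map is its own derivative, and derivatives are unique.\<close>

lemma jacobian_mult:
  fixes f :: "real^'n::finite \<Rightarrow> real^'m::finite"
  assumes "bounded_linear f"
  shows "jacobian f (at x) *v \<xi> = f \<xi>"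
proof -
  have "(f has_derivative (\<lambda>h. jacobian f (at x) *v h)) (at x)"
    using bounded_linear_imp_differentiable[OF assms] by (rule jacobian_works[THEN iffD1])
  from has_derivative_unique[OF this bounded_linear_imp_has_derivative[OF assms]]
  show ?thesis by (rule fun_cong)
qed

section \<open>The negative identity matrix, which is the W-derivative of the source\<close>

lemma uminus_matrix_vector_mult: "(- A) *v x = - (A *v x)"
  for A :: "real^'n::finite^'m::finite"
  by (simp add: vec_eq_iff matrix_vector_mult_def sum_negf)

lemma jacobian_uminus: "jacobian (\<lambda>W. - W) (at (x :: real^'r::finite)) = - mat 1"
  by (simp add: matrix_eq uminus_matrix_vector_mult
      jacobian_mult[OF bounded_linear_minus[OF bounded_linear_ident]])

lemma minus_mat_1_squared: "- mat 1 ** - mat 1 = (mat 1 :: real^'r^'r::finite)"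
  by (simp add: matrix_eq matrix_vector_mul_assoc[symmetric] uminus_matrix_vector_mult)

lemma invertible_minus_mat_1: "invertible (- mat 1 :: real^'r^'r::finite)"
  unfolding invertible_def using minus_mat_1_squared by blast

text \<open>\<open>matrix_inv\<close> is a choice operator, so its value has to come from
  uniqueness: any inverse \<open>A\<close> equals (-1)(-1)A = -1.\<close>

lemma matrix_inv_minus_mat_1: "matrix_inv (- mat 1 :: real^'r^'r::finite) = - mat 1"
  unfolding matrix_inv_def
proof (rule some_equality)
  show "- mat 1 ** - mat 1 = (mat 1 :: real^'r^'r) \<and> - mat 1 ** - mat 1 = (mat 1 :: real^'r^'r)"
    by (simp add: minus_mat_1_squared)
next
  fix A :: "real^'r^'r"
  assume "- mat 1 ** A = mat 1 \<and> A ** - mat 1 = mat 1"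
  then show "A = - mat 1"
    by (metis minus_mat_1_squared matrix_mul_assoc matrix_mul_lid matrix_mul_rid)
qed

text \<open>The symmetrizer, the Jacobian of the source and the matrix S of criterion (iv) are all
  diagonal, which reduces the matrix identities to entrywise scalings.\<close>

definition diag_mat :: "('n \<Rightarrow> real) \<Rightarrow> real^'n^'n::finite" where
  "diag_mat d = (\<chi> i k. if i = k then d i else 0)"

lemma diag_mat_mult: "diag_mat d *v \<xi> = (\<chi> i. d i * \<xi> $ i)"
  by (simp add: diag_mat_def matrix_vector_mult_def vec_eq_iff if_distrib[of "\<lambda>c. c * _"] cong: if_cong)

lemma transpose_diag_mat: "transpose (diag_mat d) = diag_mat d"
  by (simp add: diag_mat_def transpose_def vec_eq_iff)

lemma diag_mat_matrix_mult: "(diag_mat d ** M) $ i $ k = d i * M $ i $ k"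
  by (simp add: diag_mat_def matrix_matrix_mult_def if_distrib[of "\<lambda>c. c * _"] cong: if_cong)

lemma matrix_mult_diag_mat: "(M ** diag_mat d) $ i $ k = M $ i $ k * d k"
  by (simp add: diag_mat_def matrix_matrix_mult_def if_distrib[of "\<lambda>c. _ * c"] cong: if_cong)

lemma sym_pos_def_diag_mat:
  assumes "\<And>i. d i > 0"
  shows "sym_pos_def (diag_mat d)"
proof -
  have "\<xi> \<bullet> (diag_mat d *v \<xi>) > 0" if "\<xi> \<noteq> 0" for \<xi>
  proof -
    \<comment> \<open>The quadratic form is a sum of nonnegative terms; a nonzero component supplies
      one strictly positive term.\<close>
    from that obtain i where "\<xi> $ i \<noteq> 0" by (auto simp: vec_eq_iff)
    then have "0 < (\<Sum>i\<in>UNIV. d i * (\<xi> $ i)\<^sup>2)"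
      using assms by (intro sum_pos2[of _ i]) (simp_all add: less_imp_le)
    then show ?thesis
      by (simp add: inner_vec_def diag_mat_mult power2_eq_square mult.left_commute)
  qed
  then show ?thesis by (simp add: sym_pos_def_def transpose_diag_mat)
qed


section \<open>The transformed system\<close>

text \<open>Here \<open>v\<close> and \<open>w\<close> are the hatted unknowns. The equations for u
  agree, the equation for v is multiplied by \<epsilon>, and from the equation for w one subtracts
  p'(u) times the equation for u.\<close>

lemma relaxation_model_iff_transformed_model:
  fixes u :: "real \<Rightarrow> real^'d::finite \<Rightarrow> real"
  assumes p: "\<And>y. y \<in> I \<Longrightarrow> (p has_real_derivative deriv p y) (at y)"
    and \<epsilon>: "\<epsilon> \<noteq> 0"
    and u: "differentiable_tx T u" and v: "differentiable_tx T v" and w: "differentiable_tx T w"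
    and uI: "\<And>t x. t \<in> T \<Longrightarrow> u t x \<in> I"
  shows "relaxation_model p a \<epsilon> T u v w \<longleftrightarrow>
    transformed_model p a \<epsilon> T u (\<lambda>t x. \<epsilon> *\<^sub>R v t x) (\<lambda>t x. w t x - p (u t x))"
proof -
  have "(dt u t x + divergence (v t) x = 0 \<and>
     dt v t x + (1/\<epsilon>\<^sup>2) *\<^sub>R grad (w t) x = - ((1/\<epsilon>\<^sup>2) *\<^sub>R v t x) \<and>
     dt w t x + a\<^sup>2 * divergence (v t) x = (1/\<epsilon>\<^sup>2) * (p (u t x) - w t x))
   \<longleftrightarrow>
    (dt u t x + (1/\<epsilon>) * divergence (\<lambda>x. \<epsilon> *\<^sub>R v t x) x = 0 \<and>
     dt (\<lambda>t x. \<epsilon> *\<^sub>R v t x) t x + (1/\<epsilon>) *\<^sub>R grad (\<lambda>y. (w t y - p (u t y)) + p (u t y)) x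
       = - ((1/\<epsilon>\<^sup>2) *\<^sub>R (\<epsilon> *\<^sub>R v t x)) \<and>
     dt (\<lambda>t x. w t x - p (u t x)) t x
         + (1/\<epsilon>) * (a\<^sup>2 - deriv p (u t x)) * divergence (\<lambda>x. \<epsilon> *\<^sub>R v t x) x
       = - ((1/\<epsilon>\<^sup>2) * (w t x - p (u t x))))" (is "?E1 \<and> ?E2 \<and> ?E3 \<longleftrightarrow> ?F1 \<and> ?F2 \<and> ?F3")
    if t: "t \<in> T" for t x
  proof -
    have ut: "(\<lambda>s. u s x) differentiable (at t)" and vt: "(\<lambda>s. v s x) differentiable (at t)"
      and wt: "(\<lambda>s. w s x) differentiable (at t)" and vx: "v t differentiable (at x)"
      using u v w t by (auto simp: differentiable_tx_def)
    note D = p[OF uI[OF t], of x]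
    have div: "divergence (\<lambda>x. \<epsilon> *\<^sub>R v t x) x = \<epsilon> * divergence (v t) x"
      by (rule divergence_scaleR[OF vx])
    have dtv: "dt (\<lambda>t x. \<epsilon> *\<^sub>R v t x) t x = \<epsilon> *\<^sub>R dt v t x"
      by (rule dt_bounded_linear[where f = v, OF bounded_linear_scaleR_right vt])
    have "((\<lambda>s. p (u s x)) has_vector_derivative deriv p (u t x) * dt u t x) (at t)"
      using field_vector_diff_chain_at[OF has_vector_derivative_dt[of u, OF ut] D]
      by (simp add: o_def mult.commute)
    then have dtw: "dt (\<lambda>t x. w t x - p (u t x)) t x = dt w t x - deriv p (u t x) * dt u t x"
      by (intro dt_eqI has_vector_derivative_diff has_vector_derivative_dt wt)
    have 1: "?E1 \<longleftrightarrow> ?F1"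
      using \<epsilon> by (simp add: div)
    have eps: "\<epsilon> *\<^sub>R (1/\<epsilon>\<^sup>2) *\<^sub>R z = (1/\<epsilon>) *\<^sub>R z" for z :: "real^'d"
      using \<epsilon> by (simp add: power2_eq_square)
    \<comment> \<open>Under the gradient p(u) cancels and leaves the hatted w, so both sides of
      \<open>?F2\<close> are \<epsilon> times those of \<open>?E2\<close>.\<close>
    have "dt (\<lambda>t x. \<epsilon> *\<^sub>R v t x) t x + (1/\<epsilon>) *\<^sub>R grad (\<lambda>y. (w t y - p (u t y)) + p (u t y)) x
        = \<epsilon> *\<^sub>R (dt v t x + (1/\<epsilon>\<^sup>2) *\<^sub>R grad (w t) x)"
      using \<epsilon> by (simp add: dtv scaleR_add_right eps del: scaleR_scaleR)
    moreover have "- ((1/\<epsilon>\<^sup>2) *\<^sub>R (\<epsilon> *\<^sub>R v t x)) = \<epsilon> *\<^sub>R - ((1/\<epsilon>\<^sup>2) *\<^sub>R v t x)"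
      by (simp only: scaleR_minus_right scaleR_left_commute[of \<epsilon>])
    ultimately have 2: "?E2 \<longleftrightarrow> ?F2"
      using \<epsilon> by (simp only: scaleR_cancel_left) simp
    \<comment> \<open>The third equations are equivalent only modulo the first one: their left sides
      differ by p'(u) times its left side. Since \<open>?E1\<close> and \<open>?F1\<close> are
      equivalent, this suffices for the conjunctions.\<close>
    have 3: "?E3 \<longleftrightarrow> ?F3" if ?E1
    proof -
      have "dt w t x - deriv p (u t x) * dt u t x
           + (1/\<epsilon>) * (a\<^sup>2 - deriv p (u t x)) * (\<epsilon> * divergence (v t) x)
        = dt w t x + a\<^sup>2 * divergence (v t) x
          - deriv p (u t x) * (dt u t x + divergence (v t) x)"
        using \<epsilon> by (simp add: algebra_simps)
      also have "\<dots> = dt w t x + a\<^sup>2 * divergence (v t) x"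
        using that by simp
      finally have "dt w t x - deriv p (u t x) * dt u t x
           + (1/\<epsilon>) * (a\<^sup>2 - deriv p (u t x)) * (\<epsilon> * divergence (v t) x)
        = dt w t x + a\<^sup>2 * divergence (v t) x" .
      moreover have "(1/\<epsilon>\<^sup>2) * (p (u t x) - w t x) = - ((1/\<epsilon>\<^sup>2) * (w t x - p (u t x)))"
        by (simp only: mult_minus_right[symmetric] minus_diff_eq)
      ultimately show ?thesis
        unfolding div dtw by (simp only:)
    qed
    show ?thesis using 1 2 3 by blast
  qed
  then show ?thesis
    unfolding relaxation_model_def transformed_model_def by blast
qed

text \<open>The chain rule expands grad(w + p(u)) into the p'(u) grad u + grad w produced by the
  matrices. Both sides of the system are then packed vectors, and injectivity of \<open>pack\<close>
  separates the three equations.\<close>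

lemma transformed_model_iff_solves_system:
  fixes u :: "real \<Rightarrow> real^'d::finite \<Rightarrow> real"
  assumes p: "\<And>y. y \<in> I \<Longrightarrow> (p has_real_derivative deriv p y) (at y)"
    and u: "differentiable_tx T u" and v: "differentiable_tx T v" and w: "differentiable_tx T w"
    and uI: "\<And>t x. t \<in> T \<Longrightarrow> u t x \<in> I"
  shows "transformed_model p a \<epsilon> T u v w \<longleftrightarrow>
    solves_system (model_A p a) model_Q \<epsilon> T (\<lambda>t x. pack (u t x) (v t x) (w t x))"
proof -
  have "dt (\<lambda>t x. pack (u t x) (v t x) (w t x)) t x
      + (1/\<epsilon>) *\<^sub>R (\<Sum>j\<in>UNIV. model_A p a j (pack (u t x) (v t x) (w t x)) \<epsilon>
                      *v partial j (\<lambda>x. pack (u t x) (v t x) (w t x)) x)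
     = pack (dt u t x + (1/\<epsilon>) * divergence (v t) x)
        (dt v t x + (1/\<epsilon>) *\<^sub>R grad (\<lambda>y. w t y + p (u t y)) x)
        (dt w t x + (1/\<epsilon>) * (a\<^sup>2 - deriv p (u t x)) * divergence (v t) x)"
    if t: "t \<in> T" for t x
  proof -
    have ut: "(\<lambda>s. u s x) differentiable (at t)" and vt: "(\<lambda>s. v s x) differentiable (at t)"
      and wt: "(\<lambda>s. w s x) differentiable (at t)" and ux: "u t differentiable (at x)"
      and vx: "v t differentiable (at x)" and wx: "w t differentiable (at x)"
      using u v w t by (auto simp: differentiable_tx_def)
    note D = p[OF uI[OF t], of x]
    have dt_pack: "dt (\<lambda>t x. pack (u t x) (v t x) (w t x)) t x
        = pack (dt u t x) (dt v t x) (dt w t x)"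
      by (intro dt_eqI has_vector_derivative_pack has_vector_derivative_dt ut vt wt)
    have partial_pack: "partial j (\<lambda>x. pack (u t x) (v t x) (w t x)) x
        = pack (partial j (u t) x) (partial j (v t) x) (partial j (w t) x)" for j
      by (intro partial_eqI has_vector_derivative_pack has_vector_derivative_partial ux vx wx)
    have "p differentiable (at (u t x))"
      using D real_differentiable_def by blast
    then have "(\<lambda>y. p (u t y)) differentiable (at x)"
      using differentiable_chain_at[OF ux] by (simp add: o_def)
    then have "grad (\<lambda>y. w t y + p (u t y)) x
        = (\<chi> l. deriv p (u t x) * partial l (u t) x + partial l (w t) x)"
      by (simp add: grad_def partial_add partial_compose_real[of p, OF D ux] wx add.commute)
    then show ?thesis
      by (simp add: dt_pack partial_pack sum_model_A_mult_pack pack_scaleR pack_add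
          divergence_eq_sum[OF vx])
  qed
  then show ?thesis
    by (simp add: transformed_model_def solves_system_def model_Q_pack pack_scaleR pack_eq_iff)
qed

section \<open>Admissibility: openness, convexity and smoothness\<close>

lemma open_model_\<Omega>:
  assumes "open I"
  shows "open (model_\<Omega> I :: (real^(1 + ('d::finite + 1))) set)"
  unfolding model_\<Omega>_def using assms open_vimage[of I "\<lambda>y. y $ Inl 1"]
  by (simp add: vimage_def continuous_on_component)

text \<open>The matrix is affine in the number c = p'(u), hence A(c) = A(0) + c (A(1) - A(0)). The
  values c = 0 and c = 1 are realised by the zero function and the identity in place of
  \<open>p\<close>; the state and parameter \<open>0 0\<close> there are arbitrary.\<close>

lemma model_A_eq_affine:
  "model_A p a j U \<epsilon> = model_A (\<lambda>_. 0) a j 0 0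
    + deriv p (U $ Inl 1) *\<^sub>R (model_A (\<lambda>y. y) a j 0 0 - model_A (\<lambda>_. 0) a j 0 0)"
  by (simp add: model_A_def vec_eq_iff all_Plus)

lemma admissible_model:
  assumes "open I" "is_interval I" "smooth_on I p"
  shows "admissible_system (model_\<Omega>u I) (model_\<Omega> I)
    (model_A p a :: 'd::finite \<Rightarrow> real^(1 + ('d + 1)) \<Rightarrow> real \<Rightarrow> real^(1 + ('d + 1))^(1 + ('d + 1))) model_Q"
proof -
  have open_\<Omega>u: "open (model_\<Omega>u I)"
    unfolding model_\<Omega>u_def using assms(1) open_vimage[of I "\<lambda>y. y $ 1"]
    by (simp add: vimage_def continuous_on_component)
  have open_\<Omega>: "open (model_\<Omega> I :: (real^(1 + ('d + 1))) set)"
    by (rule open_model_\<Omega>[OF assms(1)])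
  have convex_\<Omega>u: "convex (model_\<Omega>u I)"
    using convex_linear_vimage[OF bounded_linear.linear[OF bounded_linear_vec_nth] is_interval_convex[OF assms(2)]]
    by (simp add: model_\<Omega>u_def vimage_def)
  have "Ck_on k (model_\<Omega> I \<times> UNIV) (\<lambda>(U, \<epsilon>). model_A p a j U \<epsilon>)" for j :: 'd and k
  proof -
    \<comment> \<open>The map (U, \<epsilon>) to p'(u) is \<open>deriv p\<close> after the linear
      projection onto u; the affine form of the matrix then gives its smoothness.\<close>
    have "bounded_linear (\<lambda>z :: (real^(1 + ('d + 1))) \<times> real. fst z $ Inl 1)"
      by (intro bounded_linear_compose[OF bounded_linear_vec_nth bounded_linear_fst])
    moreover have "Ck_on k I (deriv p)"
      using smooth_on_deriv assms unfolding smooth_on_def by blast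
    ultimately have Ck: "Ck_on k (model_\<Omega> I \<times> UNIV)
        (\<lambda>z :: (real^(1 + ('d + 1))) \<times> real. deriv p (fst z $ Inl 1))"
      using Ck_on_linear_substitution[of "\<lambda>z :: (real^(1 + ('d + 1))) \<times> real. fst z $ Inl 1"
          "model_\<Omega> I \<times> UNIV" I k "deriv p"] open_\<Omega>
      by (auto simp: open_Times model_\<Omega>_def)
    show ?thesis
      unfolding model_A_eq_affine[of p] case_prod_unfold
      by (rule Ck_on_affine[OF bounded_linear_scaleR_left open_Times[OF open_\<Omega> open_UNIV] Ck])
  qed
  then have smooth_A: "smooth_upto (model_\<Omega> I \<times> {0..1}) (\<lambda>(U, \<epsilon>). model_A p a j U \<epsilon>)" for j :: 'd
    by (intro smooth_upto_times open_\<Omega>) (simp add: smooth_on_def)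
  have "bounded_linear (\<lambda>(U :: real^(1 + ('d + 1)), \<epsilon> :: real). model_Q U \<epsilon>)"
    unfolding model_Q_def case_prod_unfold
    by (intro bounded_linear_compose[OF bounded_linear_join_zero] bounded_linear_minus
        bounded_linear_compose[OF bounded_linear_lower] bounded_linear_fst)
  then have "smooth_upto (model_\<Omega> I \<times> {0..1})
      (\<lambda>(U :: real^(1 + ('d + 1)), \<epsilon>). model_Q U \<epsilon>)"
    by (intro smooth_upto_times open_\<Omega>) (simp add: smooth_on_def Ck_on_bounded_linear)
  with smooth_A open_\<Omega>u open_\<Omega> convex_\<Omega>u show ?thesis
    by (simp add: admissible_system_def model_\<Omega>u_def model_\<Omega>_def)
qed


section \<open>The convergence criteria\<close>

lemma criterion_i_model: "criterion_i \<Omega> model_Q (\<lambda>U _. - lower U)"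
  if "open \<Omega>" for \<Omega> :: "(real^(1 + ('d::finite + 1))) set"
proof -
  have "bounded_linear (\<lambda>(U :: real^(1 + ('d + 1)), \<epsilon> :: real). - lower U)"
    unfolding case_prod_unfold
    by (intro bounded_linear_minus bounded_linear_compose[OF bounded_linear_lower] bounded_linear_fst)
  then have "smooth_upto (\<Omega> \<times> {0..1}) (\<lambda>(U :: real^(1 + ('d + 1)), \<epsilon> :: real). - lower U)"
    by (intro smooth_upto_times that) (simp add: smooth_on_def Ck_on_bounded_linear)
  then show ?thesis by (simp add: criterion_i_def model_Q_def)
qed

lemma criterion_ii_model:
  "criterion_ii \<Omega>u \<Omega> (\<lambda>U :: real^('m::finite + 'r::finite). \<lambda>_ :: real. - lower U)"
  by (simp add: criterion_ii_def jacobian_uminus invertible_minus_mat_1)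

text \<open>With \<open>c = p'(u)\<close> and \<open>b = a\<^sup>2 - c\<close>, a diagonal matrix with entries \<open>\<alpha>\<close> (for \<open>u\<close>), \<open>\<delta>\<close> (for \<open>v\<close>)
  and \<open>\<beta>\<close> (for \<open>w\<close>) symmetrizes the system iff \<open>\<alpha> = c \<delta>\<close> and \<open>\<delta> = b \<beta>\<close>; \<open>\<beta> = 1\<close> avoids
  division. The source term then satisfies (iv) with equality for \<open>S = diag(2 b, 2)\<close>.\<close>

definition model_symmetrizer ::
  "(real \<Rightarrow> real) \<Rightarrow> real \<Rightarrow> real^(1 + ('d::finite + 1)) \<Rightarrow> real \<Rightarrow>
   real^(1 + ('d + 1))^(1 + ('d + 1))" where
  "model_symmetrizer p a U \<epsilon> = (let c = deriv p (U $ Inl 1); b = a\<^sup>2 - c in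
     diag_mat (\<lambda>Inl _ \<Rightarrow> b * c | Inr (Inl _) \<Rightarrow> b | Inr (Inr _) \<Rightarrow> 1))"

lemma criterion_iii_model:
  assumes "\<And>y. y \<in> I \<Longrightarrow> 0 < deriv p y \<and> deriv p y < a\<^sup>2"
  shows "criterion_iii (model_\<Omega> I)
    (model_A p a :: 'd::finite \<Rightarrow> real^(1 + ('d + 1)) \<Rightarrow> real \<Rightarrow> real^(1 + ('d + 1))^(1 + ('d + 1)))
    (model_symmetrizer p a)"
  unfolding criterion_iii_def
proof (intro ballI conjI allI)
  fix U :: "real^(1 + ('d + 1))" and \<epsilon> :: real and j :: 'd
  assume "U \<in> model_\<Omega> I"
  then show "sym_pos_def (model_symmetrizer p a U \<epsilon>)"
    using assms unfolding model_symmetrizer_def Let_def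
    by (intro sym_pos_def_diag_mat) (auto simp: model_\<Omega>_def split: sum.split)
  show "model_symmetrizer p a U \<epsilon> ** model_A p a j U \<epsilon>
      = transpose (model_A p a j U \<epsilon>) ** model_symmetrizer p a U \<epsilon>"
    \<comment> \<open>With c = p'(u) and b = a^2 - c, the nonzero entries pair u with v_j (b c on
      both sides) and v_j with w (b on both sides).\<close>
    by (simp add: vec_eq_iff all_Plus model_symmetrizer_def Let_def diag_mat_matrix_mult
        matrix_mult_diag_mat transpose_def model_A_def)
qed

lemma bounded_linear_model_Q: "bounded_linear (\<lambda>U. model_Q U \<epsilon>)"
  unfolding model_Q_def
  by (intro bounded_linear_compose[OF bounded_linear_join_zero] bounded_linear_minus bounded_linear_lower)

text \<open>The source is linear, so its Jacobian is the source itself: it annihilates u and negates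
  v and w.\<close>

lemma jacobian_model_Q:
  "jacobian (\<lambda>U. model_Q U \<epsilon>) (at (x :: real^(1 + ('d::finite + 1))))
    = diag_mat (\<lambda>Inl _ \<Rightarrow> 0 | Inr _ \<Rightarrow> - 1)"
  unfolding matrix_eq jacobian_mult[OF bounded_linear_model_Q] diag_mat_mult
  by (simp add: vec_eq_iff all_Plus model_Q_def lower_def)

lemma criterion_iv_model:
  assumes "\<And>y. y \<in> I \<Longrightarrow> 0 < deriv p y \<and> deriv p y < a\<^sup>2"
  shows "criterion_iv (model_\<Omega>u I)
    (model_Q :: real^(1 + ('d::finite + 1)) \<Rightarrow> _) (model_symmetrizer p a)"
  unfolding criterion_iv_def
proof (intro exI ballI)
  fix u :: "real^1"
  assume "u \<in> model_\<Omega>u I"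
  then have "deriv p (u $ 1) < a\<^sup>2" using assms by (simp add: model_\<Omega>u_def)
  let ?S = "\<lambda>u :: real^1. diag_mat (\<lambda>Inl _ \<Rightarrow> 2 * (a\<^sup>2 - deriv p (u $ 1)) | Inr _ \<Rightarrow> 2)
    :: real^('d + 1)^('d + 1)"
  let ?M = "model_symmetrizer p a (join u 0) 0 :: real^(1 + ('d + 1))^(1 + ('d + 1))"
  let ?DQ = "jacobian (\<lambda>U. model_Q U 0) (at (join u 0)) :: real^(1 + ('d + 1))^(1 + ('d + 1))"
  have "sym_pos_def (?S u)"
    using \<open>deriv p (u $ 1) < a\<^sup>2\<close> by (intro sym_pos_def_diag_mat) (simp split: sum.split)
  \<comment> \<open>Both factors are diagonal, so the two summands coincide; this is the origin of
    the factor 2 in \<open>?S\<close>.\<close>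
  moreover have "?M ** ?DQ + transpose ?DQ ** ?M = - lower_block_matrix (?S u)"
    by (simp add: jacobian_model_Q transpose_diag_mat model_symmetrizer_def Let_def
        vec_eq_iff all_Plus diag_mat_matrix_mult lower_block_matrix_def) (simp add: diag_mat_def)
  ultimately show "sym_pos_def (?S u) \<and> (let M = ?M; DQ = ?DQ
      in loewner_le (M ** DQ + transpose DQ ** M) (- lower_block_matrix (?S u)))"
    unfolding Let_def by (simp only: loewner_le_def) simp
qed

lemma blk11_model_A: "blk11 (model_A p a j U \<epsilon>) = 0"
  by (simp add: blk11_def model_A_def vec_eq_iff)

lemma frechet_derivative_zero: "frechet_derivative (\<lambda>_. 0) (at x) = (\<lambda>_. 0)"
  by (rule frechet_derivative_at[OF has_derivative_const, symmetric])

lemma criterion_v_model: "criterion_v \<Omega>u (model_A p a)"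
  by (simp add: criterion_v_def blk11_model_A frechet_derivative_zero)


section \<open>The limit equation\<close>

text \<open>The derivative at the endpoint is one-sided, but still unique because the interval is
  nondegenerate; hence the chosen derivative is 0.\<close>

lemma vector_derivative_const_within_unit_interval:
  "vector_derivative (\<lambda>_. c) (at 0 within {0..1::real}) = 0"
  using vector_derivative_within_cbox[of 0 1 0 "\<lambda>_. c" 0] by simp

text \<open>The v-rows of the (2,1) blocks assemble p'(u) grad u, while the w-row has no entry in
  the u-column. The inverse of the W-derivative of q is -1 and supplies the sign.\<close>

lemma limit_W1_model:
  fixes u :: "real \<Rightarrow> real^'d::finite \<Rightarrow> real"
  assumes "u t differentiable (at x)"
  shows "limit_W1 (model_A p a) model_Q (\<lambda>t x. vec (u t x)) t x
    = join (- deriv p (u t x) *\<^sub>R grad (u t) x) 0"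
proof -
  have "partial j (\<lambda>x. vec (u t x) :: real^1) x = vec (partial j (u t) x)" for j
    by (rule partial_bounded_linear[OF bounded_linear_vec assms])
  then have "(\<Sum>j\<in>UNIV. blk21 (model_A p a j (join (vec (u t x)) 0) 0)
        *v partial j (\<lambda>x. vec (u t x) :: real^1) x)
      = join (deriv p (u t x) *\<^sub>R grad (u t) x) 0"
    by (simp add: vec_eq_iff all_Plus blk21_def model_A_def matrix_vector_mult_def sum_1 grad_def
        if_distrib[of "\<lambda>c. c * _"] cong: if_cong)
  then show ?thesis
    by (simp add: limit_W1_def model_Q_def jacobian_uminus matrix_inv_minus_mat_1
        uminus_matrix_vector_mult vector_derivative_const_within_unit_interval vec_eq_iff all_Plus)
qed

lemma limit_lhs_model:
  fixes u :: "real \<Rightarrow> real^'d::finite \<Rightarrow> real"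
  assumes p: "\<And>y. y \<in> I \<Longrightarrow> (p has_real_derivative deriv p y) (at y)"
    and p': "\<And>y. y \<in> I \<Longrightarrow> deriv p differentiable (at y)"
    and ut: "(\<lambda>s. u s x) differentiable (at t)"
    and u: "Ck_on 2 UNIV (u t)"
    and uI: "\<And>x. u t x \<in> I"
  shows "limit_lhs (model_A p a) model_Q (\<lambda>t x. vec (u t x)) t x
    = vec (dt u t x - laplacian (\<lambda>y. p (u t y)) x)"
proof -
  have u1: "u t differentiable (at y)" for y
    using u by (simp add: numeral_2_eq_2)
  \<comment> \<open>Stated as an equality of functions, so that the second order of
    \<open>Ck_on 2\<close> yields differentiability of the partial derivatives themselves.\<close>
  have "partial j (u t) = (\<lambda>y. frechet_derivative (u t) (at y) (axis j 1))" for j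
    using u1 by (simp add: fun_eq_iff partial_eq_frechet_derivative)
  then have u2: "partial j (u t) differentiable (at y)" for j y
    using u by (simp add: numeral_2_eq_2)
  let ?g = "\<lambda>j y. deriv p (u t y) * partial j (u t) y"
  have "(\<lambda>y. deriv p (u t y)) differentiable (at y)" for y
    using differentiable_chain_at[OF u1[of y] p'[OF uI]] by (simp add: o_def)
  then have g: "?g j differentiable (at y)" for j y
    using u2 by (intro differentiable_mult)
  \<comment> \<open>Thus the Laplacian of p(u) is the sum over j of the partial derivatives of
    \<open>?g j\<close>.\<close>
  have partial_p: "partial j (\<lambda>y. p (u t y)) = ?g j" for j
    by (simp add: fun_eq_iff partial_compose_real[of p, OF p[OF uI] u1])
  define W :: "real^'d \<Rightarrow> real^('d + 1)"
    where "W y = join (- deriv p (u t y) *\<^sub>R grad (u t) y) 0" for y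
  \<comment> \<open>The identification must hold at every point y, because the limit equation
    differentiates \<open>W\<close> in space.\<close>
  have W1: "limit_W1 (model_A p a) model_Q (\<lambda>t x. vec (u t x)) t = W"
    by (simp add: fun_eq_iff limit_W1_model u1 W_def)
  have "W = (\<lambda>y. \<chi> k. case k of Inl l \<Rightarrow> - ?g l y | Inr _ \<Rightarrow> 0)"
    by (simp add: fun_eq_iff W_def vec_eq_iff all_Plus grad_def)
  then have "\<forall>k. (\<lambda>y. W y $ k) differentiable (at x)"
    using g by (simp add: all_Plus)
  \<comment> \<open>Componentwise: the v-components are \<open>- ?g l\<close> and the w-component is
    0.\<close>
  then have W: "W differentiable (at x)"
    using differentiable_componentwise_within[of W x UNIV]
    by (auto simp: Basis_vec_def inner_axis)
  have "partial j W x $ Inl j = - partial j (?g j) x" for j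
  proof -
    have "partial j W x $ Inl j = partial j (\<lambda>y. W y $ Inl j) x"
      by (rule partial_component[OF W, symmetric])
    also have "\<dots> = partial j (\<lambda>y. - ?g j y) x"
      by (simp add: W_def grad_def)
    also have "\<dots> = - partial j (?g j) x"
      by (rule partial_bounded_linear[OF bounded_linear_minus[OF bounded_linear_ident] g])
    finally show ?thesis .
  qed
  \<comment> \<open>The j-th (1,2) block reads off the component v_j, so the sum over j is the
    divergence of the v-part of \<open>W\<close>.\<close>
  moreover have "blk12 (model_A p a j U \<epsilon>) *v z = vec (z $ Inl j)" for j :: 'd and U \<epsilon> z
    by (simp add: vec_eq_iff blk12_def model_A_def matrix_vector_mult_def sum_UNIV_Plus
        if_distrib[of "\<lambda>c. c * _"] cong: if_cong)
  ultimately have flux: "(\<Sum>j\<in>UNIV. blk12 (model_A p a j (join (vec (u t x)) 0) 0) *v partial j W x)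
      = vec (- laplacian (\<lambda>y. p (u t y)) x)"
    by (simp add: laplacian_def partial_p vec_eq_iff sum_negf)
  have "dt (\<lambda>t x. vec (u t x) :: real^1) t x = vec (dt u t x)"
    by (rule dt_bounded_linear[where f = u, OF bounded_linear_vec ut])
  then show ?thesis
    by (simp add: limit_lhs_def W1 flux blk11_model_A frechet_derivative_zero
        vector_derivative_const_within_unit_interval vec_eq_iff)
qed

theorem mainTheorem5:
  fixes p :: "real \<Rightarrow> real" and a :: real and I :: "real set"
  assumes "open I" and "is_interval I"
    and "smooth_on I p"
    and "\<forall>y\<in>I. 0 < deriv p y \<and> deriv p y < a\<^sup>2"
  shows
    \<comment> \<open>the substitution \<open>v = \<epsilon> vh\<close>, \<open>w = wh - p(u)\<close> gives the transformed model\<close>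
    "(\<forall>\<epsilon>\<in>{0<..1}. \<forall>T (u :: real \<Rightarrow> real^'d::finite \<Rightarrow> real) vh wh.
        open T \<and> differentiable_tx T u \<and> differentiable_tx T vh \<and> differentiable_tx T wh \<and>
        (\<forall>t\<in>T. \<forall>x. u t x \<in> I) \<longrightarrow>
        (relaxation_model p a \<epsilon> T u vh wh \<longleftrightarrow>
         transformed_model p a \<epsilon> T u (\<lambda>t x. \<epsilon> *\<^sub>R vh t x) (\<lambda>t x. wh t x - p (u t x))))
     \<and>
     \<comment> \<open>the transformed model is the first-order system with coefficients \<open>model_A\<close>, \<open>model_Q\<close>\<close>
     (\<forall>\<epsilon>\<in>{0<..1}. \<forall>T (u :: real \<Rightarrow> real^'d \<Rightarrow> real) v w.
        open T \<and> differentiable_tx T u \<and> differentiable_tx T v \<and> differentiable_tx T w \<and>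
        (\<forall>t\<in>T. \<forall>x. u t x \<in> I) \<longrightarrow>
        (transformed_model p a \<epsilon> T u v w \<longleftrightarrow>
         solves_system (model_A p a) model_Q \<epsilon> T (\<lambda>t x. pack (u t x) (v t x) (w t x))))
     \<and>
     \<comment> \<open>the convergence criteria\<close>
     admissible_system (model_\<Omega>u I) (model_\<Omega> I)
       (model_A p a :: 'd \<Rightarrow> real^(1 + ('d + 1)) \<Rightarrow> real \<Rightarrow> real^(1 + ('d + 1))^(1 + ('d + 1))) model_Q
     \<and>
     convergence_criteria (model_\<Omega>u I) (model_\<Omega> I)
       (model_A p a :: 'd \<Rightarrow> real^(1 + ('d + 1)) \<Rightarrow> real \<Rightarrow> real^(1 + ('d + 1))^(1 + ('d + 1))) model_Q
     \<and>
     \<comment> \<open>the limit equation\<close>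
     (\<forall>T (u :: real \<Rightarrow> real^'d \<Rightarrow> real).
        open T \<and> differentiable_tx T u \<and> (\<forall>t\<in>T. Ck_on 2 UNIV (u t)) \<and>
        (\<forall>t\<in>T. \<forall>x. u t x \<in> I) \<longrightarrow>
        (\<forall>t\<in>T. \<forall>x. limit_lhs (model_A p a) model_Q (\<lambda>t x. vec (u t x)) t x
                     = vec (dt u t x - laplacian (\<lambda>y. p (u t y)) x)) \<and>
        (solves_limit_equation (model_A p a) model_Q T (\<lambda>t x. vec (u t x)) \<longleftrightarrow>
         solves_diffusion p T u))"
proof (intro conjI)
  note p = smooth_on_imp_has_real_derivative[OF assms(3)]
  \<comment> \<open>The limit equation differentiates p'(u) grad u, which calls for a second
    derivative of \<open>p\<close>.\<close>
  have p': "deriv p differentiable (at y)" if "y \<in> I" for y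
    using smooth_on_imp_has_real_derivative[OF smooth_on_deriv[OF assms(1,3)] that]
    by (auto simp: real_differentiable_def)
  show "\<forall>\<epsilon>\<in>{0<..1}. \<forall>T (u :: real \<Rightarrow> real^'d \<Rightarrow> real) vh wh.
        open T \<and> differentiable_tx T u \<and> differentiable_tx T vh \<and> differentiable_tx T wh \<and>
        (\<forall>t\<in>T. \<forall>x. u t x \<in> I) \<longrightarrow>
        (relaxation_model p a \<epsilon> T u vh wh \<longleftrightarrow>
         transformed_model p a \<epsilon> T u (\<lambda>t x. \<epsilon> *\<^sub>R vh t x) (\<lambda>t x. wh t x - p (u t x)))"
    by (intro ballI allI impI, rule relaxation_model_iff_transformed_model[of I]) (auto intro: p)
  show "\<forall>\<epsilon>\<in>{0<..1}. \<forall>T (u :: real \<Rightarrow> real^'d \<Rightarrow> real) v w.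
        open T \<and> differentiable_tx T u \<and> differentiable_tx T v \<and> differentiable_tx T w \<and>
        (\<forall>t\<in>T. \<forall>x. u t x \<in> I) \<longrightarrow>
        (transformed_model p a \<epsilon> T u v w \<longleftrightarrow>
         solves_system (model_A p a) model_Q \<epsilon> T (\<lambda>t x. pack (u t x) (v t x) (w t x)))"
    by (intro ballI allI impI, rule transformed_model_iff_solves_system[of I]) (auto intro: p)
  show "admissible_system (model_\<Omega>u I) (model_\<Omega> I)
       (model_A p a :: 'd \<Rightarrow> real^(1 + ('d + 1)) \<Rightarrow> real \<Rightarrow> real^(1 + ('d + 1))^(1 + ('d + 1))) model_Q"
    by (rule admissible_model[OF assms(1-3)])
  have "open (model_\<Omega> I :: (real^(1 + ('d + 1))) set)"
    by (rule open_model_\<Omega>[OF assms(1)])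
  then show "convergence_criteria (model_\<Omega>u I) (model_\<Omega> I)
       (model_A p a :: 'd \<Rightarrow> real^(1 + ('d + 1)) \<Rightarrow> real \<Rightarrow> real^(1 + ('d + 1))^(1 + ('d + 1))) model_Q"
    unfolding convergence_criteria_def
    using criterion_i_model criterion_ii_model criterion_iii_model[of I p a]
      criterion_iv_model[of I p a] criterion_v_model assms(4) by blast
  show "\<forall>T (u :: real \<Rightarrow> real^'d \<Rightarrow> real).
        open T \<and> differentiable_tx T u \<and> (\<forall>t\<in>T. Ck_on 2 UNIV (u t)) \<and>
        (\<forall>t\<in>T. \<forall>x. u t x \<in> I) \<longrightarrow>
        (\<forall>t\<in>T. \<forall>x. limit_lhs (model_A p a) model_Q (\<lambda>t x. vec (u t x)) t x
                     = vec (dt u t x - laplacian (\<lambda>y. p (u t y)) x)) \<and>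
        (solves_limit_equation (model_A p a) model_Q T (\<lambda>t x. vec (u t x)) \<longleftrightarrow>
         solves_diffusion p T u)"
  proof (intro allI impI)
    fix T and u :: "real \<Rightarrow> real^'d \<Rightarrow> real"
    assume u: "open T \<and> differentiable_tx T u \<and> (\<forall>t\<in>T. Ck_on 2 UNIV (u t)) \<and>
      (\<forall>t\<in>T. \<forall>x. u t x \<in> I)"
    have lhs: "limit_lhs (model_A p a) model_Q (\<lambda>t x. vec (u t x)) t x
        = vec (dt u t x - laplacian (\<lambda>y. p (u t y)) x)" if "t \<in> T" for t x
      using u that by (intro limit_lhs_model[OF p p']) (auto simp: differentiable_tx_def)
    \<comment> \<open>A vector in \<open>real^1\<close> vanishes iff its single component
      does.\<close>
    then have "solves_limit_equation (model_A p a) model_Q T (\<lambda>t x. vec (u t x)) \<longleftrightarrow>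
        solves_diffusion p T u"
      by (simp add: solves_limit_equation_def solves_diffusion_def vec_eq_iff)
    with lhs show "(\<forall>t\<in>T. \<forall>x. limit_lhs (model_A p a) model_Q (\<lambda>t x. vec (u t x)) t x
        = vec (dt u t x - laplacian (\<lambda>y. p (u t y)) x)) \<and>
      (solves_limit_equation (model_A p a) model_Q T (\<lambda>t x. vec (u t x)) \<longleftrightarrow>
        solves_diffusion p T u)"
      by blast
  qed
qed

end
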